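(* Consider a hybrid system with parameter $\theta\in\mathbb{R}^p$ and a hybrid arc of it, with output sensitivity $J(t)$ along flows and post-event output sensitivities $J_j=J(\tau_j^+)$ at the event times $\tau_j$, as defined in the context. Suppose that the hybrid persistence of excitation condition (defined in the context) holds on a hybrid horizon $\mathcal H$ covering all measurements used in the salted Fisher information matrix $$\mathcal I_{\mathrm S}=\int_{\text{flows in }\mathcal H}J(t)^\top V^{-1}J(t)\,dt+\sum_{\tau_j\in\mathcal H}J_j^\top V_j^{-1}J_j ,$$ where $V\succ0$ and $V_j\succ0$. Then $\mathcal I_{\mathrm S}\succ0$.
   Context: Notation: for symmetric matrices, $A\succ 0$ ($A\succeq0$) means that $A$ is positive definite (semidefinite), and $A\succeq B$ means $A-B\succeq 0$; $I_p$ is the $p\times p$ identity matrix; superscripts $-$ and $+$ denote values immediately before and after an event; $D_x,D_\theta,D_t$ denote partial derivatives with respect to state, parameter and time. Hybrid system: a finite set $Q$ of modes and a continuous state space $X\subseteq\mathbb{R}^n$; in mode $q$ the state flows by $\dot x=f_q(x,\theta)$ while it lies in the invariant set of $q$; a transition from mode $q$ to mode $q'$ is triggered by a guard condition $g_{qq'}=0$ with scalar guard function $g_{qq'}$, and the state is then reset by the reset map $R_{qq'}$, $x^+=R_{qq'}(x^-,\theta)$. A hybrid arc is a trajectory of this system; its guard-crossing event times are denoted $\tau_j$. Standing assumption: the hybrid system is piecewise smooth, with differentiable vector fields and reset maps, transversal guard crossings ($D_tg_{qq'}^-+D_xg_{qq'}^-f_q^-\neq0$ at each event), and finitely many transitions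 on compact time intervals. Sensitivities: the state sensitivity $Z(t)=\partial x(t,\theta)/\partial\theta$ satisfies $\dot Z=D_xf_q(x,\theta)Z+D_\theta f_q(x,\theta)$ between events, and at an event $\tau_j$ (from $q$ to $q'$) it is updated by $Z(\tau_j^+)=\Xi_jZ(\tau_j^-)+D_\theta R_{qq'}(x(\tau_j^-),\theta)$, where $\Xi_j$ is the saltation matrix of the transition, $$\Xi_j=D_xR_{qq'}^-+\frac{(f_{q'}^+-D_xR_{qq'}^-f_q^--D_tR_{qq'}^-)\,D_xg_{qq'}^-}{D_tg_{qq'}^-+D_xg_{qq'}^-f_q^-}.$$ Measurements of an output $h(x,\theta)$ with Gaussian noise are available during flows (noise covariance $V$) and immediately after guard crossings (noise covariance $V_j$ at $\tau_j$). The output sensitivity is $J(t)=D_xh(x(t),\theta)Z(t)+D_\theta h(x(t),\theta)$, and $J_j=J(\tau_j^+)$ is evaluated with the post-event sensitivity $Z(\tau_j^+)$. Hybrid persistence of excitation (HPE): the hybrid regressor Gramian on a hybrid window, i.e. a time window $[t_0,t_0+\mu_t]$ with jumps $j_0,\dots,j_0+\mu_j$, is $$G_{t_0,j_0}=\int_{t_0}^{t_0+\mu_t}J(t)^\top J(t)\,dt+\sum_{k=j_0}^{j_0+\mu_j}J_k^\top J_k .$$ The system satisfies HPE if there exists $\alpha>0$ such that $G_{t_0,j_0}\succeq\alpha I_p$ for all hybrid windows. *)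

theory Defs
  imports "HOL-Analysis.Analysis"
begin

section \<open>Definite matrices\<close>

definition pos_semidef :: "real ^ 'k ^ 'k \<Rightarrow> bool" where
  "pos_semidef A \<longleftrightarrow> transpose A = A \<and> (\<forall>v. 0 \<le> v \<bullet> (A *v v))"

definition pos_def :: "real ^ 'k ^ 'k \<Rightarrow> bool" where
  "pos_def A \<longleftrightarrow> transpose A = A \<and> (\<forall>v. v \<noteq> 0 \<longrightarrow> 0 < v \<bullet> (A *v v))"

definition loewner_ge :: "real ^ 'k ^ 'k \<Rightarrow> real ^ 'k ^ 'k \<Rightarrow> bool"  (infix "\<succeq>\<^sub>L" 50) where
  "A \<succeq>\<^sub>L B \<longleftrightarrow> pos_semidef (A - B)"

definition row_deriv :: "(real ^ 'n \<Rightarrow> real) \<Rightarrow> real ^ 'n \<Rightarrow> real ^ 'n" where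
  "row_deriv \<phi> x = (\<chi> i. frechet_derivative \<phi> (at x) (axis i 1))"

definition left_lim :: "(real \<Rightarrow> 'a::t2_space) \<Rightarrow> real \<Rightarrow> 'a" where
  "left_lim u t = Lim (at_left t) u"

section \<open>Hybrid systems and hybrid arcs\<close>

text \<open>Guards depend on time and state, and resets on time, state and parameter: the saltation
  matrix contains the time derivatives of both. Time-invariant guards and resets are the special
  case of functions constant in time.\<close>

record ('q, 'n, 'p, 'm) hybrid_system =
  sys_modes :: "'q set"
  sys_states :: "(real ^ 'n) set"
  sys_inv :: "'q \<Rightarrow> (real ^ 'n) set"
  sys_flow :: "'q \<Rightarrow> real ^ 'n \<Rightarrow> real ^ 'p \<Rightarrow> real ^ 'n"
  sys_guard :: "'q \<Rightarrow> 'q \<Rightarrow> real \<Rightarrow> real ^ 'n \<Rightarrow> real"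
  sys_reset :: "'q \<Rightarrow> 'q \<Rightarrow> real \<Rightarrow> real ^ 'n \<Rightarrow> real ^ 'p \<Rightarrow> real ^ 'n"
  sys_output :: "real ^ 'n \<Rightarrow> real ^ 'p \<Rightarrow> real ^ 'm"

text \<open>The output map is continuously differentiable on the state space, so that the output
  sensitivity is piecewise continuous along an arc and the integrals below are meaningful.\<close>

definition smooth_system :: "('q, 'n::finite, 'p::finite, 'm::finite) hybrid_system \<Rightarrow> bool" where
  "smooth_system S \<longleftrightarrow>
     finite (sys_modes S) \<and>
     (\<forall>q\<in>sys_modes S. \<forall>x\<in>sys_states S. \<forall>\<theta>.
        (\<lambda>(y, \<eta>). sys_flow S q y \<eta>) differentiable at (x, \<theta>)) \<and>
     (\<forall>q\<in>sys_modes S. \<forall>q'\<in>sys_modes S. \<forall>t. \<forall>x\<in>sys_states S. \<forall>\<theta>.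
        (\<lambda>(s, y, \<eta>). sys_reset S q q' s y \<eta>) differentiable at (t, x, \<theta>)) \<and>
     (\<forall>q\<in>sys_modes S. \<forall>q'\<in>sys_modes S. \<forall>t. \<forall>x\<in>sys_states S.
        (\<lambda>(s, y). sys_guard S q q' s y) differentiable at (t, x)) \<and>
     (\<forall>x\<in>sys_states S. \<forall>\<theta>. (\<lambda>(y, \<eta>). sys_output S y \<eta>) differentiable at (x, \<theta>)) \<and>
     continuous_on (sys_states S \<times> UNIV) (\<lambda>(x, \<theta>). jacobian (\<lambda>y. sys_output S y \<theta>) (at x)) \<and>
     continuous_on (sys_states S \<times> UNIV) (\<lambda>(x, \<theta>). jacobian (sys_output S x) (at \<theta>))"

text \<open>Event \<open>j\<close> occurs at time \<open>arc_time A j\<close> and leads from \<open>arc_mode A j\<close> to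
  \<open>arc_mode A (Suc j)\<close>; the indices of the events that occur form an initial segment of the natural
  numbers. States are right-continuous: at an event time the state is the post-event one, and the
  pre-event one is the left limit.\<close>

record ('q, 'n) arc =
  arc_dom :: "real set"
  arc_events :: "nat set"
  arc_time :: "nat \<Rightarrow> real"
  arc_mode :: "nat \<Rightarrow> 'q"
  arc_state :: "real \<Rightarrow> real ^ 'n"

text \<open>The flow interval between event \<open>j - 1\<close> and event \<open>j\<close>, closed on the left and open on the
  right (up to the ends of the domain).\<close>

definition flow_piece :: "('q, 'n::finite) arc \<Rightarrow> nat \<Rightarrow> real set" where
  "flow_piece A j = {t \<in> arc_dom A.
     (\<forall>i\<in>arc_events A. i < j \<longrightarrow> arc_time A i \<le> t) \<and>
     (\<forall>i\<in>arc_events A. j \<le> i \<longrightarrow> t < arc_time A i)}"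

definition pieces :: "('q, 'n::finite) arc \<Rightarrow> nat set" where
  "pieces A = {j. {..<j} \<subseteq> arc_events A}"

definition pre_state :: "('q, 'n::finite) arc \<Rightarrow> nat \<Rightarrow> real ^ 'n" where
  "pre_state A j = left_lim (arc_state A) (arc_time A j)"

definition crossing_rate ::
  "('q, 'n::finite, 'p::finite, 'm::finite) hybrid_system \<Rightarrow> real ^ 'p \<Rightarrow> ('q, 'n) arc \<Rightarrow> nat \<Rightarrow> real" where
  "crossing_rate S \<theta> A j =
     (let q = arc_mode A j; g = sys_guard S q (arc_mode A (Suc j)); t = arc_time A j; x = pre_state A j
      in deriv (\<lambda>s. g s x) t + row_deriv (g t) x \<bullet> sys_flow S q x \<theta>)"

definition hybrid_arc ::
  "('q, 'n::finite, 'p::finite, 'm::finite) hybrid_system \<Rightarrow> real ^ 'p \<Rightarrow> ('q, 'n) arc \<Rightarrow> bool" where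
  "hybrid_arc S \<theta> A \<longleftrightarrow>
     is_interval (arc_dom A) \<and>
     (\<forall>j\<in>arc_events A. {..<j} \<subseteq> arc_events A) \<and>
     strict_mono_on (arc_events A) (arc_time A) \<and>
     (\<forall>a b. finite {j\<in>arc_events A. a \<le> arc_time A j \<and> arc_time A j \<le> b}) \<and>
     (\<forall>t\<in>arc_dom A. arc_state A t \<in> sys_states S) \<and>
     (\<forall>j\<in>pieces A. arc_mode A j \<in> sys_modes S \<and>
        (\<forall>t\<in>flow_piece A j.
           (arc_state A has_vector_derivative sys_flow S (arc_mode A j) (arc_state A t) \<theta>)
             (at t within flow_piece A j) \<and>
           (t \<notin> arc_time A ` arc_events A \<longrightarrow> arc_state A t \<in> sys_inv S (arc_mode A j)))) \<and>
     (\<forall>j\<in>arc_events A.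
        arc_time A j \<in> arc_dom A \<and> (\<exists>t\<in>arc_dom A. t < arc_time A j) \<and>
        (arc_state A \<longlongrightarrow> pre_state A j) (at_left (arc_time A j)) \<and>
        pre_state A j \<in> sys_states S \<and>
        sys_guard S (arc_mode A j) (arc_mode A (Suc j)) (arc_time A j) (pre_state A j) = 0 \<and>
        crossing_rate S \<theta> A j \<noteq> 0 \<and>
        arc_state A (arc_time A j) =
          sys_reset S (arc_mode A j) (arc_mode A (Suc j)) (arc_time A j) (pre_state A j) \<theta>)"

section \<open>Sensitivities\<close>

definition saltation ::
  "('q, 'n::finite, 'p::finite, 'm::finite) hybrid_system \<Rightarrow> real ^ 'p \<Rightarrow> ('q, 'n) arc \<Rightarrow> nat
     \<Rightarrow> real ^ 'n ^ 'n" where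
  "saltation S \<theta> A j =
     (let q = arc_mode A j; q' = arc_mode A (Suc j); t = arc_time A j;
          x = pre_state A j; x' = arc_state A t;
          R = sys_reset S q q'; g = sys_guard S q q';
          DxR = jacobian (\<lambda>y. R t y \<theta>) (at x);
          DtR = vector_derivative (\<lambda>s. R s x \<theta>) (at t);
          u = sys_flow S q' x' \<theta> - DxR *v sys_flow S q x \<theta> - DtR;
          w = row_deriv (g t) x
      in DxR + (\<chi> i k. u $ i * w $ k / crossing_rate S \<theta> A j))"

text \<open>\<open>arcs \<eta>\<close> is the arc for the parameter value \<open>\<eta>\<close>, i.e. \<open>x(t,\<eta>) = arc_state (arcs \<eta>) t\<close>.
  Away from the events, \<open>Z t\<close> is the derivative of \<open>x(t,\<eta>)\<close> with respect to \<open>\<eta>\<close> at \<open>\<theta>\<close>. Event times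
  move with the parameter, so at an event time that derivative need not exist; there \<open>Z\<close> is
  right-continuous, i.e. it takes the post-event value.\<close>

definition state_sensitivity ::
  "('q, 'n::finite, 'p::finite, 'm::finite) hybrid_system \<Rightarrow> real ^ 'p \<Rightarrow> (real ^ 'p \<Rightarrow> ('q, 'n) arc)
     \<Rightarrow> (real \<Rightarrow> real ^ 'p ^ 'n) \<Rightarrow> bool" where
  "state_sensitivity S \<theta> arcs Z \<longleftrightarrow>
     (let A = arcs \<theta> in
     (\<forall>t\<in>arc_dom A - arc_time A ` arc_events A.
        (\<forall>\<^sub>F \<eta> in nhds \<theta>. t \<in> arc_dom (arcs \<eta>)) \<and>
        ((\<lambda>\<eta>. arc_state (arcs \<eta>) t) has_derivative (\<lambda>v. Z t *v v)) (at \<theta>)) \<and>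
     (\<forall>j\<in>pieces A. \<forall>t\<in>flow_piece A j.
        (Z has_vector_derivative
           jacobian (\<lambda>y. sys_flow S (arc_mode A j) y \<theta>) (at (arc_state A t)) ** Z t
           + jacobian (sys_flow S (arc_mode A j) (arc_state A t)) (at \<theta>))
          (at t within flow_piece A j)) \<and>
     (\<forall>j\<in>arc_events A.
        (Z \<longlongrightarrow> left_lim Z (arc_time A j)) (at_left (arc_time A j)) \<and>
        Z (arc_time A j) =
          saltation S \<theta> A j ** left_lim Z (arc_time A j)
          + jacobian (sys_reset S (arc_mode A j) (arc_mode A (Suc j)) (arc_time A j) (pre_state A j))
              (at \<theta>)))"

definition output_sensitivity ::
  "('q, 'n::finite, 'p::finite, 'm::finite) hybrid_system \<Rightarrow> real ^ 'p \<Rightarrow> ('q, 'n) arc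
     \<Rightarrow> (real \<Rightarrow> real ^ 'p ^ 'n) \<Rightarrow> real \<Rightarrow> real ^ 'p ^ 'm" where
  "output_sensitivity S \<theta> A Z t =
     jacobian (\<lambda>y. sys_output S y \<theta>) (at (arc_state A t)) ** Z t
     + jacobian (sys_output S (arc_state A t)) (at \<theta>)"

text \<open>State and \<open>Z\<close> are right-continuous, so this is the post-event value.\<close>

definition event_sensitivity ::
  "('q, 'n::finite, 'p::finite, 'm::finite) hybrid_system \<Rightarrow> real ^ 'p \<Rightarrow> ('q, 'n) arc
     \<Rightarrow> (real \<Rightarrow> real ^ 'p ^ 'n) \<Rightarrow> nat \<Rightarrow> real ^ 'p ^ 'm" where
  "event_sensitivity S \<theta> A Z j = output_sensitivity S \<theta> A Z (arc_time A j)"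

section \<open>Persistence of excitation and Fisher information\<close>

text \<open>A portion of the hybrid time domain of the arc: the time interval \<open>[t0, t0 + \<mu>t]\<close> with the
  jumps \<open>j0, ..., j0 + \<mu>j\<close>. These are the jumps in that interval; a jump at an end point of
  the interval may belong to the portion or not. Both the windows of the excitation condition and the
  horizon are of this form.\<close>

definition hybrid_window :: "('q, 'n::finite) arc \<Rightarrow> real \<Rightarrow> real \<Rightarrow> nat \<Rightarrow> nat \<Rightarrow> bool" where
  "hybrid_window A t0 \<mu>t j0 \<mu>j \<longleftrightarrow>
     {t0..t0 + \<mu>t} \<subseteq> arc_dom A \<and>
     {j0..j0 + \<mu>j} \<subseteq> {k\<in>arc_events A. arc_time A k \<in> {t0..t0 + \<mu>t}} \<and>
     {k\<in>arc_events A. arc_time A k \<in> {t0<..<t0 + \<mu>t}} \<subseteq> {j0..j0 + \<mu>j}"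

definition window_in_horizon ::
  "('q, 'n::finite) arc \<Rightarrow> real \<Rightarrow> real \<Rightarrow> nat \<Rightarrow> nat \<Rightarrow> real \<Rightarrow> nat \<Rightarrow> real \<Rightarrow> nat \<Rightarrow> bool" where
  "window_in_horizon A T0 T J0 N \<mu>t \<mu>j t0 j0 \<longleftrightarrow>
     hybrid_window A t0 \<mu>t j0 \<mu>j \<and>
     {t0..t0 + \<mu>t} \<subseteq> {T0..T0 + T} \<and> {j0..j0 + \<mu>j} \<subseteq> {J0..J0 + N}"

definition regressor_gramian ::
  "('q, 'n::finite, 'p::finite, 'm::finite) hybrid_system \<Rightarrow> real ^ 'p \<Rightarrow> ('q, 'n) arc
     \<Rightarrow> (real \<Rightarrow> real ^ 'p ^ 'n) \<Rightarrow> real \<Rightarrow> nat \<Rightarrow> real \<Rightarrow> nat \<Rightarrow> real ^ 'p ^ 'p" where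
  "regressor_gramian S \<theta> A Z \<mu>t \<mu>j t0 j0 =
     integral {t0..t0 + \<mu>t}
       (\<lambda>t. transpose (output_sensitivity S \<theta> A Z t) ** output_sensitivity S \<theta> A Z t)
     + (\<Sum>k=j0..j0 + \<mu>j. transpose (event_sensitivity S \<theta> A Z k) ** event_sensitivity S \<theta> A Z k)"

definition HPE_on ::
  "('q, 'n::finite, 'p::finite, 'm::finite) hybrid_system \<Rightarrow> real ^ 'p \<Rightarrow> ('q, 'n) arc
     \<Rightarrow> (real \<Rightarrow> real ^ 'p ^ 'n) \<Rightarrow> real \<Rightarrow> real \<Rightarrow> nat \<Rightarrow> nat \<Rightarrow> real \<Rightarrow> nat \<Rightarrow> bool" where
  "HPE_on S \<theta> A Z T0 T J0 N \<mu>t \<mu>j \<longleftrightarrow>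
     (\<exists>\<alpha>>0. \<forall>t0 j0. window_in_horizon A T0 T J0 N \<mu>t \<mu>j t0 j0 \<longrightarrow>
        regressor_gramian S \<theta> A Z \<mu>t \<mu>j t0 j0 \<succeq>\<^sub>L \<alpha> *\<^sub>R mat 1)"

definition salted_fisher ::
  "('q, 'n::finite, 'p::finite, 'm::finite) hybrid_system \<Rightarrow> real ^ 'p \<Rightarrow> ('q, 'n) arc
     \<Rightarrow> (real \<Rightarrow> real ^ 'p ^ 'n) \<Rightarrow> real ^ 'm ^ 'm \<Rightarrow> (nat \<Rightarrow> real ^ 'm ^ 'm)
     \<Rightarrow> real \<Rightarrow> real \<Rightarrow> nat \<Rightarrow> nat \<Rightarrow> real ^ 'p ^ 'p" where
  "salted_fisher S \<theta> A Z V W T0 T J0 N =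
     integral {T0..T0 + T}
       (\<lambda>t. transpose (output_sensitivity S \<theta> A Z t) ** matrix_inv V ** output_sensitivity S \<theta> A Z t)
     + (\<Sum>k=J0..J0 + N.
          transpose (event_sensitivity S \<theta> A Z k) ** matrix_inv (W k) ** event_sensitivity S \<theta> A Z k)"

end

theory Submission
  imports Defs
begin

text \<open>The inverse covariances are positive definite, so there is one \<open>c > 0\<close> with
  \<open>y \<bullet> (V\<^sup>-\<^sup>1 y) \<ge> c \<bar>y\<bar>\<^sup>2\<close> and likewise for each \<open>W k\<close>. Hence
  the quadratic form of the Fisher information at \<open>v\<close> is at least \<open>c\<close> times the energy
  \<open>\<integral> \<bar>J v\<bar>\<^sup>2 + \<Sum> \<bar>J\<^sub>k v\<bar>\<^sup>2\<close> over the horizon, hence at least \<open>c\<close> times the energy over an excitation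
  window contained in it, which is at least \<open>\<alpha> \<bar>v\<bar>\<^sup>2\<close>. As \<open>integral\<close> is a junk value for
  functions that are not integrable, the argument also needs integrability of the quadratic
  expressions in \<open>J\<close>; this holds since \<open>J\<close> is continuous on each flow interval and has left limits at
  the events.\<close>

section \<open>Definite matrices and quadratic forms\<close>

lemma bounded_bilinear_matrix_matrix_mult:
  "bounded_bilinear ((**) :: real^'n^'m \<Rightarrow> real^'k^'n \<Rightarrow> real^'k^'m)"
  unfolding bilinear_conv_bounded_bilinear[symmetric] bilinear_def
  by (auto intro!: linearI simp: vec_eq_iff matrix_matrix_mult_def algebra_simps sum.distrib
      sum_distrib_left)

lemma bounded_linear_transpose: "bounded_linear (transpose :: real^'n^'m \<Rightarrow> real^'m^'n)"
  by (intro linear_conv_bounded_linear[THEN iffD1] linearI)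
    (auto simp: vec_eq_iff transpose_def)

text \<open>For a fixed vector the form is linear in the matrix, which lets it pass through the
  matrix-valued integral by \<open>integral_linear\<close>.\<close>

lemma bounded_linear_quadratic_form:
  fixes v :: "real^'n"
  shows "bounded_linear (\<lambda>M. v \<bullet> (M *v v))"
  by (intro linear_conv_bounded_linear[THEN iffD1] linearI)
    (auto simp: matrix_vector_mult_add_rdistrib inner_add_right scaleR_matrix_vector_assoc[symmetric])

lemma quadratic_form_congruence:
  fixes J :: "real^'p^'m" and B :: "real^'m^'m"
  shows "v \<bullet> ((transpose J ** B ** J) *v v) = (J *v v) \<bullet> (B *v (J *v v))"
  by (metis dot_lmul_matrix matrix_vector_mul_assoc vector_transpose_matrix)

lemma transpose_congruence:
  fixes J :: "real^'p^'m" and B :: "real^'m^'m"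
  assumes "transpose B = B"
  shows "transpose (transpose J ** B ** J) = transpose J ** B ** J"
  by (simp add: matrix_transpose_mul assms matrix_mul_assoc)

lemma continuous_on_congruence:
  fixes B :: "real^'m^'m"
  shows "continuous_on UNIV (\<lambda>J :: real^'p^'m. transpose J ** B ** J)"
  by (intro bounded_bilinear.continuous_on[OF bounded_bilinear_matrix_matrix_mult]
      bounded_linear.continuous_on[OF bounded_linear_transpose] continuous_intros)

text \<open>The substitution y = M z turns the form of the inverse at y into the form of M at
  z.\<close>

lemma pos_def_matrix_inv:
  fixes M :: "real^'m^'m"
  assumes M: "pos_def M"
  shows "pos_def (matrix_inv M)"
proof -
  have sym: "transpose M = M" and pos: "\<And>v. v \<noteq> 0 \<Longrightarrow> 0 < v \<bullet> (M *v v)"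
    using M by (auto simp: pos_def_def)
  have "x = 0" if "M *v x = 0" for x
    using pos[of x] that by auto
  then have "\<exists>B. B ** M = mat 1"
    by (simp add: matrix_left_invertible_ker)
  then have "\<exists>B. M ** B = mat 1 \<and> B ** M = mat 1"
    using matrix_left_right_inverse by blast
  \<comment> \<open>\<open>matrix_inv\<close> is defined by choice, so its two identities are
    available only once a two-sided inverse exists; a trivial kernel provides a left inverse, and
    for square matrices this is two-sided.\<close>
  then have inv: "M ** matrix_inv M = mat 1" "matrix_inv M ** M = mat 1"
    unfolding matrix_inv_def by (metis (mono_tags, lifting) someI_ex)+
  \<comment> \<open>Transposing M ** \<open>matrix_inv M\<close> = 1 makes the transpose a left
    inverse of the symmetric M, and left and right inverses coincide.\<close>
  have "transpose (matrix_inv M) ** M = mat 1"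
    by (metis inv(1) sym matrix_transpose_mul transpose_mat)
  then have "transpose (matrix_inv M) = matrix_inv M"
    by (metis inv(1) matrix_mul_assoc matrix_mul_lid matrix_mul_rid)
  moreover have "0 < y \<bullet> (matrix_inv M *v y)" if "y \<noteq> 0" for y
  proof -
    define z where "z = matrix_inv M *v y"
    have y: "y = M *v z"
      by (simp add: z_def matrix_vector_mul_assoc inv)
    with that have "z \<noteq> 0"
      by auto
    then show ?thesis
      using pos[of z] by (simp add: z_def[symmetric] y[symmetric] inner_commute)
  qed
  ultimately show ?thesis
    by (auto simp: pos_def_def)
qed

text \<open>The constant is the minimum of the form on the unit sphere, attained by compactness and
  positive because the minimizer is nonzero. Homogeneity of degree 2 carries the bound to all
  vectors.\<close>

lemma pos_def_lower_bound:
  fixes M :: "real^'m^'m"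
  assumes M: "pos_def M"
  obtains c where "c > 0" "\<And>y. c * (y \<bullet> y) \<le> y \<bullet> (M *v y)"
proof -
  have "\<exists>u\<in>sphere 0 1. \<forall>y\<in>sphere 0 1. u \<bullet> (M *v u) \<le> y \<bullet> (M *v y)"
    by (intro continuous_attains_inf continuous_intros
        linear_continuous_on[OF matrix_vector_mul_bounded_linear]) auto
  then obtain u :: "real^'m" where u: "norm u = 1"
    and min: "\<And>y. norm y = 1 \<Longrightarrow> u \<bullet> (M *v u) \<le> y \<bullet> (M *v y)"
    by auto
  show thesis
  proof
    show "0 < u \<bullet> (M *v u)"
    proof -
      have "u \<noteq> 0"
        using u by auto
      with M show ?thesis
        by (simp add: pos_def_def)
    qed
    fix y
    show "(u \<bullet> (M *v u)) * (y \<bullet> y) \<le> y \<bullet> (M *v y)"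
    proof (cases "y = 0")
      case False
      define w where "w = y /\<^sub>R norm y"
      have y: "y = norm y *\<^sub>R w"
        using False by (simp add: w_def)
      have "norm w = 1"
        using False by (simp add: w_def)
      then have "(u \<bullet> (M *v u)) * (norm y)\<^sup>2 \<le> (w \<bullet> (M *v w)) * (norm y)\<^sup>2"
        by (intro mult_right_mono min) auto
      also have "\<dots> = (norm y *\<^sub>R w) \<bullet> (M *v (norm y *\<^sub>R w))"
        by (simp add: matrix_vector_mult_scaleR power2_eq_square)
      also have "\<dots> = y \<bullet> (M *v y)"
        by (simp only: y[symmetric])
      finally show ?thesis
        by (simp add: power2_norm_eq_inner)
    qed auto
  qed
qed

lemma pos_def_common_lower_bound:
  fixes \<M> :: "(real^'m^'m) set"
  assumes "finite \<M>" and "\<And>M. M \<in> \<M> \<Longrightarrow> pos_def M"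
  shows "\<exists>c>0. \<forall>M\<in>\<M>. \<forall>y. c * (y \<bullet> y) \<le> y \<bullet> (M *v y)"
  using assms
proof (induction \<M> rule: finite_induct)
  case empty
  show ?case
    by (auto intro: exI[of _ 1])
next
  case (insert M \<M>)
  then obtain c where c: "c > 0" "\<forall>M\<in>\<M>. \<forall>y. c * (y \<bullet> y) \<le> y \<bullet> (M *v y)"
    by auto
  obtain d where d: "d > 0" "\<And>y. d * (y \<bullet> y) \<le> y \<bullet> (M *v y)"
    using pos_def_lower_bound insert.prems by (metis insertI1)
  have "min c d * (y \<bullet> y) \<le> c * (y \<bullet> y)" "min c d * (y \<bullet> y) \<le> d * (y \<bullet> y)" for y :: "real^'m"
    by (auto intro!: mult_right_mono)
  then have "min c d * (y \<bullet> y) \<le> y \<bullet> (N *v y)" if "N \<in> insert M \<M>" for N y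
    using that c(2) d(2) order_trans by (metis insertE)
  then show ?case
    using c d by (intro exI[of _ "min c d"]) auto
qed

section \<open>Integrability of regulated functions\<close>

text \<open>By compactness it suffices that every t is the tag of small intervals on which f is
  integrable (\<open>integrable_on_little_subintervals\<close>). Such an interval splits at t: the
  right half is covered by continuity up to and including t, the left half by the left
  limit.\<close>

lemma integrable_on_one_sided_continuous:
  fixes f :: "real \<Rightarrow> 'a::banach"
  assumes right: "\<And>t. \<lbrakk>a \<le> t; t < b\<rbrakk> \<Longrightarrow> \<exists>d>t. continuous_on {t..<d} f"
    and left: "\<And>t. \<lbrakk>a < t; t \<le> b\<rbrakk> \<Longrightarrow>
      \<exists>c<t. continuous_on {c<..<t} f \<and> (\<exists>l. (f \<longlongrightarrow> l) (at_left t))"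
  shows "f integrable_on {a..b}"
proof -
  have "\<exists>\<delta>>0. \<forall>u v. t \<in> cbox u v \<and> cbox u v \<subseteq> ball t \<delta> \<and> cbox u v \<subseteq> cbox a b \<longrightarrow>
      f integrable_on cbox u v" if t: "t \<in> cbox a b" for t
  proof -
    \<comment> \<open>At the end points a or b one of the two hypotheses is silent; there t + 1 or t
      - 1 is a placeholder and the continuity claim is vacuous.\<close>
    obtain d where d: "d > t" "t < b \<Longrightarrow> continuous_on {t..<d} f"
      using right[of t] t by (cases "t < b") (auto intro: that[of "t + 1"])
    obtain c l where c: "c < t" "a < t \<Longrightarrow> continuous_on {c<..<t} f \<and> (f \<longlongrightarrow> l) (at_left t)"
      using left[of t] t by (cases "a < t") (auto intro: that[of "t - 1"])
    show ?thesis
    proof (intro exI[of _ "min (t - c) (d - t)"] conjI allI impI)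
      show "0 < min (t - c) (d - t)"
        using c d by simp
      fix u v
      assume uv: "t \<in> cbox u v \<and> cbox u v \<subseteq> ball t (min (t - c) (d - t)) \<and> cbox u v \<subseteq> cbox a b"
      then have "u \<in> cbox u v" "v \<in> cbox u v"
        by auto
      with uv have "u \<in> ball t (min (t - c) (d - t))" "v \<in> ball t (min (t - c) (d - t))"
        by blast+
      with uv have b: "u \<le> t" "t \<le> v" "c < u" "v < d" "a \<le> u" "v \<le> b"
        by (auto simp: dist_real_def)
      have "f integrable_on {t..v}"
      proof (cases "t < v")
        case True
        with b have "t < b"
          by simp
        then have "continuous_on {t..v} f"
          by (rule continuous_on_subset[OF d(2)]) (use b in auto)
        then show ?thesis
          by (rule integrable_continuous_interval)
      next
        case False
        with b have "t = v"
          by simp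
        then show ?thesis
          using integrable_on_refl[of f t] by simp
      qed
      moreover have "f integrable_on {u..t}"
      proof (cases "u < t")
        case True
        with b have "a < t"
          by simp
        note c2 = c(2)[OF this]
        have isC: "(f \<longlongrightarrow> f s) (at s)" if "u \<le> s" "s < t" for s
          using c2 that b by (simp add: continuous_on_eq_continuous_at isCont_def)
        \<comment> \<open>Replacing the value at t by the left limit gives a continuous function on
          the closed interval. It differs from f at one point only, so integrability carries over to
          f.\<close>
        have "continuous_on {u..t} (f(t := l))"
        proof (rule continuous_on_IccI)
          have "((f(t := l)) \<longlongrightarrow> f s) (at s)" if "u \<le> s" "s < t" for s
          proof (rule Lim_transform_eventually[OF isC[OF that]])
            show "\<forall>\<^sub>F x in at s. f x = (f(t := l)) x"
              by (rule eventually_mono[OF eventually_at_in_open'[of "{..<t}" s]]) (use that in auto)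
          qed
          then show "((f(t := l)) \<longlongrightarrow> (f(t := l)) u) (at_right u)"
            and "\<And>s. \<lbrakk>u < s; s < t\<rbrakk> \<Longrightarrow> (f(t := l)) \<midarrow>s\<rightarrow> (f(t := l)) s"
            using True by (auto intro: filterlim_at_split[THEN iffD1, THEN conjunct2])
          show "((f(t := l)) \<longlongrightarrow> (f(t := l)) t) (at_left t)"
          proof (rule Lim_transform_eventually[of f])
            show "(f \<longlongrightarrow> (f(t := l)) t) (at_left t)"
              using c2 by simp
            show "\<forall>\<^sub>F x in at_left t. f x = (f(t := l)) x"
              by (auto simp: eventually_at_filter)
          qed
        qed (use True in auto)
        then have "(f(t := l)) integrable_on {u..t}"
          by (rule integrable_continuous_interval)
        then show ?thesis
          by (rule integrable_spike_finite[of "{t}", rotated 2]) auto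
      next
        case False
        with b have "u = t"
          by simp
        then show ?thesis
          using integrable_on_refl[of f t] by simp
      qed
      ultimately show "f integrable_on cbox u v"
        using b Henstock_Kurzweil_Integration.integrable_combine[of u t v f] by simp
    qed
  qed
  then show ?thesis
    using integrable_on_little_subintervals[of a b f] by simp
qed

section \<open>Flow intervals of a hybrid arc\<close>

lemma finite_initial_segment_nat:
  fixes E :: "nat set"
  assumes fin: "finite E" and down: "\<And>i j. \<lbrakk>j \<in> E; i < j\<rbrakk> \<Longrightarrow> i \<in> E"
  obtains j where "E = {..<j}"
proof
  obtain i where "i \<notin> E"
    using fin ex_new_if_finite infinite_UNIV_nat by blast
  then have "(LEAST i. i \<notin> E) \<notin> E"
    by (rule LeastI)
  then show "E = {..<LEAST i. i \<notin> E}"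
    using down not_less_Least by (auto simp: not_less_iff_gr_or_eq) (metis linorder_neqE_nat)
qed

text \<open>Local finiteness of events is assumed only on bounded time intervals. Event 0 is the
  earliest one, so it bounds all past events from below.\<close>

lemma hybrid_arc_finite_past:
  assumes "hybrid_arc S \<theta> A"
  shows "finite {i \<in> arc_events A. arc_time A i \<le> t}"
proof (rule finite_subset)
  have down: "\<forall>j\<in>arc_events A. {..<j} \<subseteq> arc_events A"
    and mono: "strict_mono_on (arc_events A) (arc_time A)"
    using assms by (auto simp: hybrid_arc_def)
  show "{i \<in> arc_events A. arc_time A i \<le> t} \<subseteq>
      {i \<in> arc_events A. arc_time A 0 \<le> arc_time A i \<and> arc_time A i \<le> t}"
  proof clarsimp
    fix i assume "i \<in> arc_events A"
    then show "arc_time A 0 \<le> arc_time A i"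
      using down strict_mono_onD[OF mono, of 0 i] by (cases "i = 0") (force simp: less_imp_le)+
  qed
  show "finite {i \<in> arc_events A. arc_time A 0 \<le> arc_time A i \<and> arc_time A i \<le> t}"
    using assms by (simp add: hybrid_arc_def)
qed

text \<open>The index j counts the events up to and including t, so at an event time it selects the
  piece that starts there.\<close>

lemma flow_piece_right:
  assumes A: "hybrid_arc S \<theta> A" and t: "t \<in> arc_dom A"
  obtains j d where "j \<in> pieces A" "d > t" "{t..<d} \<inter> arc_dom A \<subseteq> flow_piece A j"
proof -
  have down: "\<And>i j. \<lbrakk>j \<in> arc_events A; i < j\<rbrakk> \<Longrightarrow> i \<in> arc_events A"
    and mono: "\<And>i j. \<lbrakk>i \<in> arc_events A; j \<in> arc_events A; i < j\<rbrakk> \<Longrightarrow> arc_time A i < arc_time A j"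
    using A by (auto simp: hybrid_arc_def strict_mono_on_def)
  obtain j where j: "{i \<in> arc_events A. arc_time A i \<le> t} = {..<j}"
  proof (rule finite_initial_segment_nat[OF hybrid_arc_finite_past[OF A]])
    fix i k assume k: "k \<in> {i \<in> arc_events A. arc_time A i \<le> t}" "i < k"
    then show "i \<in> {i \<in> arc_events A. arc_time A i \<le> t}"
      using down[of k i] mono[of i k] by auto
  qed
  have past: "i < j \<longleftrightarrow> i \<in> arc_events A \<and> arc_time A i \<le> t" for i
    using j by blast
  \<comment> \<open>The next event time, or an arbitrary later time if no event follows.\<close>
  define d where "d = (if j \<in> arc_events A then arc_time A j else t + 1)"
  show thesis
  proof
    show "j \<in> pieces A"
      using past by (auto simp: pieces_def)
    show "d > t"
      using past[of j] by (auto simp: d_def)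
    show "{t..<d} \<inter> arc_dom A \<subseteq> flow_piece A j"
    proof
      fix s assume s: "s \<in> {t..<d} \<inter> arc_dom A"
      have "s < arc_time A i" if i: "i \<in> arc_events A" "j \<le> i" for i
      proof -
        have "j \<in> arc_events A"
          using down[of i j] i by (cases "i = j") auto
        moreover from this have "arc_time A j \<le> arc_time A i"
          using mono[of j i] i by (cases "i = j") auto
        ultimately show ?thesis
          using s by (simp add: d_def)
      qed
      then show "s \<in> flow_piece A j"
        using s past by (force simp: flow_piece_def)
    qed
  qed
qed

text \<open>Here j counts the events strictly before t, so at an event time it selects the piece
  that ends there. The last conclusion separates the two sources of a left limit: t lies in the
  piece itself, or t is the time of event j.\<close>

lemma flow_piece_left:
  assumes A: "hybrid_arc S \<theta> A"
  obtains j c where "j \<in> pieces A" "c < t" "{c<..<t} \<inter> arc_dom A \<subseteq> flow_piece A j"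
    "t \<in> arc_dom A \<Longrightarrow> {c<..t} \<inter> arc_dom A \<subseteq> flow_piece A j \<or> j \<in> arc_events A \<and> t = arc_time A j"
proof -
  have down: "\<And>i j. \<lbrakk>j \<in> arc_events A; i < j\<rbrakk> \<Longrightarrow> i \<in> arc_events A"
    and mono: "\<And>i j. \<lbrakk>i \<in> arc_events A; j \<in> arc_events A; i < j\<rbrakk> \<Longrightarrow> arc_time A i < arc_time A j"
    using A by (auto simp: hybrid_arc_def strict_mono_on_def)
  have "finite {i \<in> arc_events A. arc_time A i < t}"
    using hybrid_arc_finite_past[OF A, of t] by (rule rev_finite_subset) auto
  then obtain j where j: "{i \<in> arc_events A. arc_time A i < t} = {..<j}"
  proof (rule finite_initial_segment_nat)
    fix i k assume k: "k \<in> {i \<in> arc_events A. arc_time A i < t}" "i < k"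
    then show "i \<in> {i \<in> arc_events A. arc_time A i < t}"
      using down[of k i] mono[of i k] by auto
  qed
  have past: "i < j \<longleftrightarrow> i \<in> arc_events A \<and> arc_time A i < t" for i
    using j by blast
  \<comment> \<open>The last event before t has index j - 1; for j = 0 there is none, and any
    earlier time serves.\<close>
  define c where "c = (if j = 0 then t - 1 else arc_time A (j - 1))"
  have before: "arc_time A i \<le> c" if "i < j" for i
  proof (cases "i = j - 1")
    case False
    with that have "i < j - 1"
      by simp
    with that show ?thesis
      using past[of i] past[of "j - 1"] mono[of i "j - 1"] by (simp add: c_def)
  qed (use that in \<open>simp add: c_def\<close>)
  \<comment> \<open>Strict monotonicity of the event times allows only event j to occur at t
    itself.\<close>
  have after: "t < arc_time A i \<or> i = j \<and> t = arc_time A j" if "i \<in> arc_events A" "j \<le> i" for i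
    using that past[of i] past[of j] down[of i j] mono[of j i] by (cases "i = j") auto
  show thesis
  proof
    show "j \<in> pieces A"
      using past by (auto simp: pieces_def)
    show "c < t"
      using past[of "j - 1"] by (auto simp: c_def)
    show "{c<..<t} \<inter> arc_dom A \<subseteq> flow_piece A j"
      using before after by (force simp: flow_piece_def)
    show "{c<..t} \<inter> arc_dom A \<subseteq> flow_piece A j \<or> j \<in> arc_events A \<and> t = arc_time A j"
      using before after by (force simp: flow_piece_def)
  qed
qed

section \<open>Regularity of the output sensitivity\<close>

lemma smooth_system_jacobian_continuous:
  assumes "smooth_system S"
  shows "continuous_on (sys_states S) (\<lambda>x. jacobian (\<lambda>y. sys_output S y \<theta>) (at x))"
    and "continuous_on (sys_states S) (\<lambda>x. jacobian (sys_output S x) (at \<theta>))"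
proof -
  have 1: "continuous_on (sys_states S \<times> UNIV)
      (\<lambda>p. jacobian (\<lambda>y. sys_output S y (snd p)) (at (fst p)))"
    and 2: "continuous_on (sys_states S \<times> UNIV)
      (\<lambda>p. jacobian (sys_output S (fst p)) (at (snd p)))"
    using assms by (auto simp: smooth_system_def case_prod_beta)
  show "continuous_on (sys_states S) (\<lambda>x. jacobian (\<lambda>y. sys_output S y \<theta>) (at x))"
    using continuous_on_compose2[OF 1, of "sys_states S" "\<lambda>x. (x, \<theta>)"]
    by (simp add: continuous_on_Pair image_subset_iff)
  show "continuous_on (sys_states S) (\<lambda>x. jacobian (sys_output S x) (at \<theta>))"
    using continuous_on_compose2[OF 2, of "sys_states S" "\<lambda>x. (x, \<theta>)"]
    by (simp add: continuous_on_Pair image_subset_iff)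
qed

text \<open>State and \<open>Z\<close> are differentiable within the piece, hence continuous, and
  the output Jacobians are continuous along states in the state space.\<close>

lemma continuous_on_flow_piece_output_sensitivity:
  assumes smooth: "smooth_system S" and arc: "hybrid_arc S \<theta> (arcs \<theta>)"
    and sens: "state_sensitivity S \<theta> arcs Z" and j: "j \<in> pieces (arcs \<theta>)"
  shows "continuous_on (flow_piece (arcs \<theta>) j) (output_sensitivity S \<theta> (arcs \<theta>) Z)"
proof -
  have Z: "continuous_on (flow_piece (arcs \<theta>) j) Z"
    using sens j by (auto simp: state_sensitivity_def Let_def continuous_on_eq_continuous_within
        intro: has_vector_derivative_continuous)
  have x: "continuous_on (flow_piece (arcs \<theta>) j) (arc_state (arcs \<theta>))"
    using arc j has_vector_derivative_continuous
    unfolding hybrid_arc_def continuous_on_eq_continuous_within by blast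
  have sub: "arc_state (arcs \<theta>) ` flow_piece (arcs \<theta>) j \<subseteq> sys_states S"
    using arc by (auto simp: hybrid_arc_def flow_piece_def)
  show ?thesis
    unfolding output_sensitivity_def
    by (intro continuous_on_add bounded_bilinear.continuous_on[OF bounded_bilinear_matrix_matrix_mult]
        Z continuous_on_compose2[OF smooth_system_jacobian_continuous(1)[OF smooth] x sub]
        continuous_on_compose2[OF smooth_system_jacobian_continuous(2)[OF smooth] x sub])
qed

text \<open>State and \<open>Z\<close> have left limits at an event. The pre-event state lies in the
  state space, so the output Jacobians are continuous there.\<close>

lemma output_sensitivity_left_limit:
  assumes smooth: "smooth_system S" and arc: "hybrid_arc S \<theta> (arcs \<theta>)"
    and sens: "state_sensitivity S \<theta> arcs Z" and j: "j \<in> arc_events (arcs \<theta>)"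
  shows "\<exists>l. (output_sensitivity S \<theta> (arcs \<theta>) Z \<longlongrightarrow> l) (at_left (arc_time (arcs \<theta>) j))"
proof -
  let ?A = "arcs \<theta>"
  let ?t = "arc_time ?A j"
  have Z: "(Z \<longlongrightarrow> left_lim Z ?t) (at_left ?t)"
    using sens j by (auto simp: state_sensitivity_def Let_def)
  have x: "(arc_state ?A \<longlongrightarrow> pre_state ?A j) (at_left ?t)" and pre: "pre_state ?A j \<in> sys_states S"
    using arc j by (auto simp: hybrid_arc_def)
  obtain s where "?t \<in> arc_dom ?A" "s \<in> arc_dom ?A" "s < ?t" "is_interval (arc_dom ?A)"
    using arc j by (auto simp: hybrid_arc_def)
  \<comment> \<open>The domain is an interval containing an earlier time, so it contains all times
    just before the event.\<close>
  then have "\<forall>\<^sub>F r in at_left ?t. r \<in> arc_dom ?A"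
    unfolding eventually_at_left_field by (meson less_imp_le mem_is_interval_1_I)
  then have ev: "\<forall>\<^sub>F r in at_left ?t. arc_state ?A r \<in> sys_states S"
    by eventually_elim (use arc in \<open>auto simp: hybrid_arc_def\<close>)
  show ?thesis
    unfolding output_sensitivity_def
    by (rule exI, rule tendsto_add,
        rule bounded_bilinear.tendsto[OF bounded_bilinear_matrix_matrix_mult],
        rule continuous_on_tendsto_compose[OF smooth_system_jacobian_continuous(1)[OF smooth] x pre ev],
        rule Z,
        rule continuous_on_tendsto_compose[OF smooth_system_jacobian_continuous(2)[OF smooth] x pre ev])
qed

text \<open>A general continuous \<phi> covers both the Gramian and the Fisher integrand, which are
  the maps J to J^T B J for different weights B.\<close>

lemma integrable_on_continuous_output_sensitivity:
  fixes S :: "('q, 'n::finite, 'p::finite, 'm::finite) hybrid_system"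
    and \<phi> :: "real ^ 'p ^ 'm \<Rightarrow> 'b::banach"
  assumes smooth: "smooth_system S" and arc: "hybrid_arc S \<theta> (arcs \<theta>)"
    and sens: "state_sensitivity S \<theta> arcs Z" and dom: "{a..b} \<subseteq> arc_dom (arcs \<theta>)"
    and \<phi>: "continuous_on UNIV \<phi>"
  shows "(\<lambda>t. \<phi> (output_sensitivity S \<theta> (arcs \<theta>) Z t)) integrable_on {a..b}"
proof (rule integrable_on_one_sided_continuous)
  let ?J = "output_sensitivity S \<theta> (arcs \<theta>) Z"
  have cont: "continuous_on K (\<lambda>t. \<phi> (?J t))" if "j \<in> pieces (arcs \<theta>)" "K \<subseteq> flow_piece (arcs \<theta>) j" for j K
    by (rule continuous_on_compose2[OF \<phi> continuous_on_subset[OF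
        continuous_on_flow_piece_output_sensitivity[OF smooth arc sens that(1)] that(2)]]) auto
  fix t
  {
    assume t: "a \<le> t" "t < b"
    with dom have "t \<in> arc_dom (arcs \<theta>)"
      by auto
    then obtain j d where j: "j \<in> pieces (arcs \<theta>)" "d > t"
      "{t..<d} \<inter> arc_dom (arcs \<theta>) \<subseteq> flow_piece (arcs \<theta>) j"
      using flow_piece_right[OF arc] by blast
    have "{t..<min d b} \<subseteq> flow_piece (arcs \<theta>) j"
      using j dom t by fastforce
    then show "\<exists>d>t. continuous_on {t..<d} (\<lambda>t. \<phi> (?J t))"
      using j t by (intro exI[of _ "min d b"] conjI cont) auto
  }
  {
    assume t: "a < t" "t \<le> b"
    with dom have "t \<in> arc_dom (arcs \<theta>)"
      by auto
    then obtain j c where j: "j \<in> pieces (arcs \<theta>)" "c < t"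
      "{c<..<t} \<inter> arc_dom (arcs \<theta>) \<subseteq> flow_piece (arcs \<theta>) j"
      "{c<..t} \<inter> arc_dom (arcs \<theta>) \<subseteq> flow_piece (arcs \<theta>) j \<or>
        j \<in> arc_events (arcs \<theta>) \<and> t = arc_time (arcs \<theta>) j"
      using flow_piece_left[OF arc, of t] by metis
    let ?c = "max c a"
    have "{?c<..<t} \<subseteq> flow_piece (arcs \<theta>) j"
      using j(3) dom t by fastforce
    then have "continuous_on {?c<..<t} (\<lambda>t. \<phi> (?J t))"
      using j by (intro cont)
    moreover have "\<exists>l. ((\<lambda>t. \<phi> (?J t)) \<longlongrightarrow> l) (at_left t)"
      using j(4)
    proof
      assume "{c<..t} \<inter> arc_dom (arcs \<theta>) \<subseteq> flow_piece (arcs \<theta>) j"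
      \<comment> \<open>The midpoint is a left end strictly between \<open>?c\<close> and t, which
        yields a closed interval inside the piece and hence continuity from the left at t.\<close>
      then have "{(?c + t) / 2..t} \<subseteq> flow_piece (arcs \<theta>) j"
        using dom t j(2) by (fastforce simp: field_simps)
      then have "continuous_on {(?c + t) / 2..t} (\<lambda>t. \<phi> (?J t))"
        using j by (intro cont)
      then show ?thesis
        using continuous_on_Icc_at_leftD[of "(?c + t) / 2" t] t j(2) by fastforce
    next
      assume "j \<in> arc_events (arcs \<theta>) \<and> t = arc_time (arcs \<theta>) j"
      then obtain l where "(?J \<longlongrightarrow> l) (at_left t)"
        using output_sensitivity_left_limit[OF smooth arc sens] by blast
      then have "((\<lambda>t. \<phi> (?J t)) \<longlongrightarrow> \<phi> l) (at_left t)"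
        by (intro continuous_on_tendsto_compose[OF \<phi>]) auto
      then show ?thesis ..
    qed
    ultimately show "\<exists>c<t. continuous_on {c<..<t} (\<lambda>t. \<phi> (?J t)) \<and> (\<exists>l. ((\<lambda>t. \<phi> (?J t)) \<longlongrightarrow> l) (at_left t))"
      using j t by (intro exI[of _ ?c]) auto
  }
qed

section \<open>Fisher information\<close>

text \<open>Symmetry is part of \<open>pos_def\<close>. Transposition is bounded linear, so it
  passes through the integral and fixes each integrand and summand.\<close>

lemma transpose_integral_congruence:
  fixes J :: "real \<Rightarrow> real^'p^'m" and B :: "real^'m^'m" and C :: "nat \<Rightarrow> real^'m^'m"
  assumes int: "(\<lambda>t. transpose (J t) ** B ** J t) integrable_on X"
    and B: "transpose B = B" and C: "\<And>k. k \<in> K \<Longrightarrow> transpose (C k) = C k"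
  shows "transpose (integral X (\<lambda>t. transpose (J t) ** B ** J t) + (\<Sum>k\<in>K. transpose (L k) ** C k ** L k))
    = integral X (\<lambda>t. transpose (J t) ** B ** J t) + (\<Sum>k\<in>K. transpose (L k) ** C k ** L k)"
proof -
  interpret bounded_linear "transpose :: real^'p^'p \<Rightarrow> real^'p^'p"
    by (rule bounded_linear_transpose)
  show ?thesis
    by (simp add: add sum integral_linear[OF int bounded_linear_axioms, unfolded o_def, symmetric]
        transpose_congruence B C)
qed

text \<open>With arbitrary weights this serves twice: identity weights give the Gramian, inverse
  covariances the Fisher information.\<close>

lemma quadratic_form_integral_congruence:
  fixes J :: "real \<Rightarrow> real^'p^'m" and B :: "real^'m^'m" and C :: "nat \<Rightarrow> real^'m^'m"
  assumes int: "(\<lambda>t. transpose (J t) ** B ** J t) integrable_on X"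
  shows "v \<bullet> ((integral X (\<lambda>t. transpose (J t) ** B ** J t)
        + (\<Sum>k\<in>K. transpose (L k) ** C k ** L k)) *v v)
    = integral X (\<lambda>t. (J t *v v) \<bullet> (B *v (J t *v v))) + (\<Sum>k\<in>K. (L k *v v) \<bullet> (C k *v (L k *v v)))"
proof -
  interpret bounded_linear "\<lambda>M :: real^'p^'p. v \<bullet> (M *v v)"
    by (rule bounded_linear_quadratic_form)
  show ?thesis
    unfolding add sum integral_linear[OF int bounded_linear_axioms, unfolded o_def, symmetric]
      quadratic_form_congruence ..
qed

text \<open>\<open>HPE_on\<close> speaks only of windows inside the horizon; \<open>covers\<close>
  supplies one, so the excitation condition is not vacuous.\<close>

theorem mainTheorem1:
  fixes S :: "('q, 'n::finite, 'p::finite, 'm::finite) hybrid_system"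
    and \<theta> :: "real ^ 'p"
    and arcs :: "real ^ 'p \<Rightarrow> ('q, 'n) arc"
    and Z :: "real \<Rightarrow> real ^ 'p ^ 'n"
    and V :: "real ^ 'm ^ 'm" and W :: "nat \<Rightarrow> real ^ 'm ^ 'm"
    and T0 T \<mu>t :: real and J0 N \<mu>j :: nat
  assumes smooth: "smooth_system S"
    and arcs: "\<forall>\<^sub>F \<eta> in nhds \<theta>. hybrid_arc S \<eta> (arcs \<eta>)"
    and sens: "state_sensitivity S \<theta> arcs Z"
    and horizon: "hybrid_window (arcs \<theta>) T0 T J0 N"
    and covers: "\<exists>t0 j0. window_in_horizon (arcs \<theta>) T0 T J0 N \<mu>t \<mu>j t0 j0"
    and hpe: "HPE_on S \<theta> (arcs \<theta>) Z T0 T J0 N \<mu>t \<mu>j"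
    and V: "pos_def V"
    and W: "\<And>j. j \<in> {J0..J0 + N} \<Longrightarrow> pos_def (W j)"
  shows "pos_def (salted_fisher S \<theta> (arcs \<theta>) Z V W T0 T J0 N)"
proof -
  let ?J = "output_sensitivity S \<theta> (arcs \<theta>) Z" and ?L = "event_sensitivity S \<theta> (arcs \<theta>) Z"
  let ?I = "{T0..T0 + T}" and ?K = "{J0..J0 + N}"
  have arc: "hybrid_arc S \<theta> (arcs \<theta>)"
    using arcs by (rule eventually_nhds_x_imp_x)
  have dom: "?I \<subseteq> arc_dom (arcs \<theta>)"
    using horizon by (simp add: hybrid_window_def)
  note integrable = integrable_on_continuous_output_sensitivity[OF smooth arc sens]
  have invV: "pos_def (matrix_inv V)" and invW: "\<And>k. k \<in> ?K \<Longrightarrow> pos_def (matrix_inv (W k))"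
    using V W pos_def_matrix_inv by blast+
  obtain t0 j0 where win: "window_in_horizon (arcs \<theta>) T0 T J0 N \<mu>t \<mu>j t0 j0"
    using covers by blast
  let ?I' = "{t0..t0 + \<mu>t}" and ?K' = "{j0..j0 + \<mu>j}"
  have sub: "?I' \<subseteq> ?I" "?K' \<subseteq> ?K"
    using win by (simp_all add: window_in_horizon_def)
  obtain \<alpha> where "\<alpha> > 0"
    and \<alpha>: "regressor_gramian S \<theta> (arcs \<theta>) Z \<mu>t \<mu>j t0 j0 \<succeq>\<^sub>L \<alpha> *\<^sub>R mat 1"
    using hpe win by (auto simp: HPE_on_def)
  \<comment> \<open>The horizon contains finitely many jumps, so one constant serves the flow weight
    and all event weights.\<close>
  have "\<exists>c>0. \<forall>M\<in>insert (matrix_inv V) ((\<lambda>k. matrix_inv (W k)) ` ?K). \<forall>y. c * (y \<bullet> y) \<le> y \<bullet> (M *v y)"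
    using invV invW by (intro pos_def_common_lower_bound) auto
  then obtain c where "c > 0" and cV: "\<And>y. c * (y \<bullet> y) \<le> y \<bullet> (matrix_inv V *v y)"
    and cW: "\<And>k y. k \<in> ?K \<Longrightarrow> c * (y \<bullet> y) \<le> y \<bullet> (matrix_inv (W k) *v y)"
    by auto
  have int_fisher: "(\<lambda>t. transpose (?J t) ** matrix_inv V ** ?J t) integrable_on ?I"
    by (rule integrable[OF dom continuous_on_congruence])
  have "0 < v \<bullet> (salted_fisher S \<theta> (arcs \<theta>) Z V W T0 T J0 N *v v)" if "v \<noteq> 0" for v
  proof -
    let ?e = "\<lambda>t. (?J t *v v) \<bullet> (?J t *v v)" and ?f = "\<lambda>k. (?L k *v v) \<bullet> (?L k *v v)"
    have form: "(\<lambda>t. (?J t *v v) \<bullet> (B *v (?J t *v v))) integrable_on {a..b}"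
      if "{a..b} \<subseteq> ?I" for a b and B :: "real^'m^'m"
      using integrable_linear[OF integrable[OF order_trans[OF that dom] continuous_on_congruence[of B]]
          bounded_linear_quadratic_form[of v]]
      unfolding o_def quadratic_form_congruence .
    have energy: "?e integrable_on {a..b}" if "{a..b} \<subseteq> ?I" for a b
      using form[OF that, of "mat 1"] by simp
    have "0 \<le> v \<bullet> ((regressor_gramian S \<theta> (arcs \<theta>) Z \<mu>t \<mu>j t0 j0 - \<alpha> *\<^sub>R mat 1) *v v)"
      using \<alpha> by (simp add: loewner_ge_def pos_semidef_def)
    then have "\<alpha> * (v \<bullet> v) \<le> v \<bullet> (regressor_gramian S \<theta> (arcs \<theta>) Z \<mu>t \<mu>j t0 j0 *v v)"
      by (simp add: matrix_vector_mult_diff_rdistrib inner_diff_right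
          scaleR_matrix_vector_assoc[symmetric])
    also have "\<dots> = integral ?I' ?e + sum ?f ?K'"
      using quadratic_form_integral_congruence[of ?J "mat 1" ?I' v ?L "\<lambda>_. mat 1" ?K']
        integrable[OF order_trans[OF sub(1) dom] continuous_on_congruence, of "mat 1"]
      by (simp add: regressor_gramian_def)
    \<comment> \<open>Passing from the window to the horizon adds only squared norms, which are
      nonnegative.\<close>
    also have "\<dots> \<le> integral ?I ?e + sum ?f ?K"
      using sub by (intro add_mono integral_subset_le sum_mono2 energy) auto
    finally have "c * (\<alpha> * (v \<bullet> v)) \<le> c * (integral ?I ?e + sum ?f ?K)"
      using \<open>c > 0\<close> by simp
    also have "\<dots> = integral ?I (\<lambda>t. c * ?e t) + (\<Sum>k\<in>?K. c * ?f k)"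
      by (simp add: distrib_left sum_distrib_left)
    \<comment> \<open>The bounds \<open>cV\<close> and \<open>cW\<close> are applied at each time
      with y = J(t) v and at each event with y = J_k v.\<close>
    also have "\<dots> \<le> integral ?I (\<lambda>t. (?J t *v v) \<bullet> (matrix_inv V *v (?J t *v v)))
        + (\<Sum>k\<in>?K. (?L k *v v) \<bullet> (matrix_inv (W k) *v (?L k *v v)))"
      by (intro add_mono integral_le sum_mono cV cW integrable_on_mult_right energy form) auto
    also have "\<dots> = v \<bullet> (salted_fisher S \<theta> (arcs \<theta>) Z V W T0 T J0 N *v v)"
      unfolding salted_fisher_def by (rule quadratic_form_integral_congruence[OF int_fisher, symmetric])
    finally show ?thesis
      using \<open>c > 0\<close> \<open>\<alpha> > 0\<close> that by (smt (verit) inner_gt_zero_iff mult_pos_pos)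
  qed
  moreover have "transpose (salted_fisher S \<theta> (arcs \<theta>) Z V W T0 T J0 N)
      = salted_fisher S \<theta> (arcs \<theta>) Z V W T0 T J0 N"
    unfolding salted_fisher_def
    using invV invW by (intro transpose_integral_congruence[OF int_fisher]) (auto simp: pos_def_def)
  ultimately show ?thesis
    by (auto simp: pos_def_def)
qed

end
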